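(* Let $m\ge1$ be a fixed integer, let $X$ be an arbitrary subset of $\omega$, let $A=(a_{nk})_{n,k\ge1}$ be an infinite complex matrix, and let $E=(e_{nk})$ be given by $$e_{nk}=\sum_{j=1}^{n}\left[\sum_{i=j}^{n}\frac{(-1)^{i-j}}{n+i-1}\binom{m}{i-j}\right]a_{jk}\qquad(n,k\ge1).$$ Then: (i) $A\in(X:h_{0}(\Delta^{(m)}))$ if and only if $E\in(X:c_0)$. (ii) $A\in(X:h_{c}(\Delta^{(m)}))$ if and only if $E\in(X:c)$. (iii) $A\in(X:h_{\infty}(\Delta^{(m)}))$ if and only if $E\in(X:\ell_\infty)$.
   Context: $\omega$ is the space of all complex sequences $x=(x_k)_{k\ge1}$; $\ell_\infty$, $c$, $c_0$ are the spaces of bounded, convergent and null sequences. For $X,Y\subseteq\omega$, $(X:Y)$ is the set of infinite complex matrices $A=(a_{nk})$ such that for every $x\in X$ all series $(Ax)_n=\sum_k a_{nk}x_k$ converge and $Ax\in Y$. Put $x_k=0$ for $k\le 0$. The difference operator of order $m$ is $(\Delta^{(m)}x)_k=\sum_{i=0}^m(-1)^i\binom{m}{i}x_{k-i}$. The $H\Delta^{(m)}$-transform of $x\in\omega$ is $$(H\Delta^{(m)}x)_n=\sum_{k=1}^n\frac{1}{n+k-1}(\Delta^{(m)}x)_k=\sum_{k=1}^{n}\left[\sum_{i=k}^{n}\frac{(-1)^{i-k}}{n+i-1}\binom{m}{i-k}\right]x_k,$$ i.e. $H$ acts as the lower triangular matrix with entries $\frac1{n+k-1}$ for $1\le k\le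 n$ and $0$ for $k>n$. The spaces are $h_c(\Delta^{(m)})=\{x\in\omega: H\Delta^{(m)}x\in c\}$, $h_0(\Delta^{(m)})=\{x\in\omega: H\Delta^{(m)}x\in c_0\}$, $h_\infty(\Delta^{(m)})=\{x\in\omega: H\Delta^{(m)}x\in \ell_\infty\}$. *)

theory Defs
  imports Complex_Main
begin

text \<open>
  A sequence \<open>(x\<^sub>k)\<close>, \<open>k \<ge> 1\<close>, is a function on \<^typ>\<open>nat\<close> with the junk
  coordinate \<open>x 0\<close> fixed to \<open>0\<close>, so that elements of \<open>omega\<close> correspond one-to-one to
  complex sequences indexed from \<open>1\<close>.
  An infinite matrix is a function \<open>nat \<Rightarrow> nat \<Rightarrow> complex\<close>; only its entries with both
  indices \<open>\<ge> 1\<close> are ever used.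
\<close>

definition omega :: "(nat \<Rightarrow> complex) set" where
  "omega = {x. x 0 = 0}"

definition linf_space :: "(nat \<Rightarrow> complex) set" where
  "linf_space = {x \<in> omega. Bseq x}"

definition c_space :: "(nat \<Rightarrow> complex) set" where
  "c_space = {x \<in> omega. convergent x}"

definition c0_space :: "(nat \<Rightarrow> complex) set" where
  "c0_space = {x \<in> omega. x \<longlonglongrightarrow> 0}"

definition mat_app :: "(nat \<Rightarrow> nat \<Rightarrow> complex) \<Rightarrow> (nat \<Rightarrow> complex) \<Rightarrow> nat \<Rightarrow> complex" where
  "mat_app A x n = (if n = 0 then 0 else (\<Sum>k. A n (Suc k) * x (Suc k)))"

definition matrix_class ::
    "(nat \<Rightarrow> complex) set \<Rightarrow> (nat \<Rightarrow> complex) set \<Rightarrow> (nat \<Rightarrow> nat \<Rightarrow> complex) set" where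
  "matrix_class X Y =
     {A. \<forall>x\<in>X. (\<forall>n\<ge>1. summable (\<lambda>k. A n (Suc k) * x (Suc k))) \<and> mat_app A x \<in> Y}"

text \<open>The guard implements the convention \<open>x\<^sub>k = 0\<close> for \<open>k \<le> 0\<close>
  (subtraction on \<^typ>\<open>nat\<close> truncates).\<close>

definition Delta :: "nat \<Rightarrow> (nat \<Rightarrow> complex) \<Rightarrow> nat \<Rightarrow> complex" where
  "Delta m x k = (\<Sum>i=0..m. (-1) ^ i * of_nat (m choose i) * (if i < k then x (k - i) else 0))"

definition HDelta :: "nat \<Rightarrow> (nat \<Rightarrow> complex) \<Rightarrow> nat \<Rightarrow> complex" where
  "HDelta m x n = (\<Sum>k=1..n. 1 / of_nat (n + k - 1) * Delta m x k)"

definition h_c :: "nat \<Rightarrow> (nat \<Rightarrow> complex) set" where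
  "h_c m = {x \<in> omega. HDelta m x \<in> c_space}"

definition h_0 :: "nat \<Rightarrow> (nat \<Rightarrow> complex) set" where
  "h_0 m = {x \<in> omega. HDelta m x \<in> c0_space}"

definition h_inf :: "nat \<Rightarrow> (nat \<Rightarrow> complex) set" where
  "h_inf m = {x \<in> omega. HDelta m x \<in> linf_space}"

lemma Delta_eq:
  "Delta m x k = (\<Sum>j=1..k. (-1) ^ (k - j) * of_nat (m choose (k - j)) * x j)"
proof -
  let ?f = "\<lambda>i. (-1) ^ i * of_nat (m choose i) * (if i < k then x (k - i) else 0)"
  have "Delta m x k = (\<Sum>i\<in>{0..m} \<inter> {..<k}. ?f i)"
    unfolding Delta_def by (rule sum.mono_neutral_right) auto
  also have "\<dots> = (\<Sum>i<k. ?f i)"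
    by (rule sum.mono_neutral_left) auto
  also have "\<dots> = (\<Sum>j=1..k. (-1) ^ (k - j) * of_nat (m choose (k - j)) * x j)"
    by (rule sum.reindex_bij_witness[of _ "\<lambda>j. k - j" "\<lambda>i. k - i"]) auto
  finally show ?thesis .
qed

text \<open>The lower triangular matrix representing \<open>HDelta m\<close>.\<close>

lemma HDelta_eq:
  "HDelta m x n =
     (\<Sum>k=1..n. (\<Sum>i=k..n. (-1) ^ (i - k) / of_nat (n + i - 1) * of_nat (m choose (i - k))) * x k)"
proof -
  let ?g = "\<lambda>i k. (-1) ^ (i - k) / of_nat (n + i - 1) * of_nat (m choose (i - k)) * x k"
  have "HDelta m x n = (\<Sum>i=1..n. \<Sum>k=1..i. ?g i k)"
    unfolding HDelta_def Delta_eq by (simp add: sum_distrib_left)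
  also have "\<dots> = (\<Sum>k=1..n. \<Sum>i=k..n. ?g i k)"
    unfolding sum.Sigma[OF finite_atLeastAtMost ballI[OF finite_atLeastAtMost]]
      by (rule sum.reindex_bij_witness[of _ "\<lambda>(a,b). (b,a)" "\<lambda>(a,b). (b,a)"]) auto
  finally show ?thesis by (simp add: sum_distrib_right)
qed

end

theory Submission
  imports Defs
begin

text \<open>
  The transform \<open>H\<Delta>\<^sup>(\<^sup>m\<^sup>)\<close> is given by a lower triangular matrix \<open>T\<close>, and \<open>E\<close> is the product \<open>T A\<close>.
  Each row of \<open>T\<close> is finite, so \<open>T (A x) = (T A) x = E x\<close> as soon as the series defining
  \<open>A x\<close> converge (\<open>HDelta_mat_app\<close>); hence \<open>A x\<close> lies in the domain of \<open>T\<close> over a sequence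
  space \<open>Y\<close> exactly if \<open>E x \<in> Y\<close>.

  The point that needs care is the existence of the series in the converse direction: the
  terms of \<open>(E x)\<^sub>n\<close> are combinations of the terms of \<open>(A x)\<^sub>1, \<dots>, (A x)\<^sub>n\<close>, and their
  summability has to give back that of the terms of \<open>A x\<close>. This holds because the diagonal
  entries \<open>1 / (2 n - 1)\<close> of \<open>T\<close> do not vanish, so the system can be solved
  by forward substitution (\<open>summable_triangular_iff\<close>). The three claims are the same
  argument for \<open>Y = c\<^sub>0\<close>, \<open>Y = c\<close> and \<open>Y = \<ell>\<^sub>\<infinity>\<close>.
\<close>

definition HDelta_matrix :: "nat \<Rightarrow> nat \<Rightarrow> nat \<Rightarrow> complex" where
  "HDelta_matrix m n j =
     (\<Sum>i=j..n. (-1) ^ (i - j) / of_nat (n + i - 1) * of_nat (m choose (i - j)))"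

lemma HDelta_conv_matrix: "HDelta m y n = (\<Sum>j=1..n. HDelta_matrix m n j * y j)"
  by (simp add: HDelta_eq HDelta_matrix_def)

lemma HDelta_matrix_diag_nonzero:
  assumes "n \<ge> 1"
  shows "HDelta_matrix m n n \<noteq> 0"
proof -
  have "HDelta_matrix m n n = 1 / of_nat (n + n - 1)"
    by (simp add: HDelta_matrix_def)
  moreover have "n + n - 1 \<noteq> 0"
    using assms by simp
  ultimately show ?thesis
    by (simp only: divide_eq_0_iff of_nat_eq_0_iff one_neq_zero) simp
qed

text \<open>
  Forward substitution: once the first \<open>n - 1\<close> series are known to converge, subtracting
  their contribution from the \<open>n\<close>-th combination leaves \<open>T n n\<close> times the \<open>n\<close>-th series.
\<close>

lemma summable_triangular_iff:
  fixes T :: "nat \<Rightarrow> nat \<Rightarrow> 'a :: real_normed_field"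
  assumes diag: "\<And>n. n \<ge> 1 \<Longrightarrow> T n n \<noteq> 0"
  shows "(\<forall>n\<ge>1. summable (\<lambda>k. \<Sum>j=1..n. T n j * f j k)) \<longleftrightarrow> (\<forall>n\<ge>1. summable (f n))"
    (is "?comb \<longleftrightarrow> ?each")
proof
  assume comb: ?comb
  have "summable (f n)" if "n \<ge> 1" for n
    using that
  proof (induction n rule: less_induct)
    case (less n)
    have "summable (\<lambda>k. \<Sum>j=1..<n. T n j * f j k)"
      by (intro summable_sum summable_mult less.IH) auto
    with comb less.prems
    have "summable (\<lambda>k. (\<Sum>j=1..n. T n j * f j k) - (\<Sum>j=1..<n. T n j * f j k))"
      by (intro summable_diff) auto
    moreover have "(\<Sum>j=1..n. T n j * f j k) = (\<Sum>j=1..<n. T n j * f j k) + T n n * f n k" for k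
      using less.prems by (simp add: sum.last_plus)
    ultimately have "summable (\<lambda>k. T n n * f n k)"
      by simp
    then show ?case
      using diag[OF less.prems] by (simp add: summable_cmult_iff)
  qed
  then show ?each
    by blast
next
  assume ?each
  then show ?comb
    by (intro allI impI summable_sum summable_mult) auto
qed

text \<open>
  Associativity \<open>T (A x) = (T A) x\<close>: each row of \<open>T\<close> is a finite sum, which can be
  exchanged with the convergent series.
\<close>

lemma HDelta_mat_app:
  assumes E: "\<And>n k. n \<ge> 1 \<Longrightarrow> k \<ge> 1 \<Longrightarrow> E n k = (\<Sum>j=1..n. HDelta_matrix m n j * A j k)"
    and summable_A: "\<And>n. n \<ge> 1 \<Longrightarrow> summable (\<lambda>k. A n (Suc k) * x (Suc k))"
  shows "HDelta m (mat_app A x) = mat_app E x"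
proof
  fix n
  show "HDelta m (mat_app A x) n = mat_app E x n"
  proof (cases "n = 0")
    case True
    then show ?thesis
      by (simp add: HDelta_def mat_app_def)
  next
    case False
    have "HDelta m (mat_app A x) n =
        (\<Sum>j=1..n. \<Sum>k. HDelta_matrix m n j * (A j (Suc k) * x (Suc k)))"
      unfolding HDelta_conv_matrix
      by (rule sum.cong) (auto simp: mat_app_def suminf_mult summable_A)
    also have "\<dots> = (\<Sum>k. \<Sum>j=1..n. HDelta_matrix m n j * (A j (Suc k) * x (Suc k)))"
      by (rule suminf_sum[symmetric]) (auto intro!: summable_mult summable_A)
    also have "\<dots> = mat_app E x n"
      using False by (simp add: mat_app_def E sum_distrib_right mult.assoc)
    finally show ?thesis .
  qed
qed

lemma matrix_class_HDelta_domain_iff: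
  assumes E: "\<And>n k. n \<ge> 1 \<Longrightarrow> k \<ge> 1 \<Longrightarrow> E n k = (\<Sum>j=1..n. HDelta_matrix m n j * A j k)"
  shows "A \<in> matrix_class X {y \<in> omega. HDelta m y \<in> Y} \<longleftrightarrow> E \<in> matrix_class X Y"
proof -
  have summable_iff: "(\<forall>n\<ge>1. summable (\<lambda>k. E n (Suc k) * x (Suc k))) \<longleftrightarrow>
      (\<forall>n\<ge>1. summable (\<lambda>k. A n (Suc k) * x (Suc k)))" for x
    using summable_triangular_iff[of "HDelta_matrix m" "\<lambda>n k. A n (Suc k) * x (Suc k)",
        OF HDelta_matrix_diag_nonzero]
    by (simp add: E sum_distrib_right mult.assoc)
  have "(\<forall>n\<ge>1. summable (\<lambda>k. A n (Suc k) * x (Suc k))) \<and>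
        mat_app A x \<in> {y \<in> omega. HDelta m y \<in> Y} \<longleftrightarrow>
      (\<forall>n\<ge>1. summable (\<lambda>k. E n (Suc k) * x (Suc k))) \<and> mat_app E x \<in> Y" for x
  proof (cases "\<forall>n\<ge>1. summable (\<lambda>k. A n (Suc k) * x (Suc k))")
    case True
    have "mat_app A x \<in> omega"
      by (simp add: omega_def mat_app_def)
    moreover have "HDelta m (mat_app A x) = mat_app E x"
      using E True by (intro HDelta_mat_app) blast+
    ultimately show ?thesis
      unfolding summable_iff by simp
  next
    case False
    then show ?thesis
      unfolding summable_iff by blast
  qed
  then show ?thesis
    by (simp only: matrix_class_def mem_Collect_eq)
qed

theorem theorem3p6:
  fixes m :: nat
    and X :: "(nat \<Rightarrow> complex) set"
    and A E :: "nat \<Rightarrow> nat \<Rightarrow> complex"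
  assumes "m \<ge> 1"
    and "X \<subseteq> omega"
    and "\<And>n k. n \<ge> 1 \<Longrightarrow> k \<ge> 1 \<Longrightarrow>
           E n k = (\<Sum>j=1..n. (\<Sum>i=j..n. (-1) ^ (i - j) / of_nat (n + i - 1)
                                       * of_nat (m choose (i - j))) * A j k)"
  shows "(A \<in> matrix_class X (h_0 m) \<longleftrightarrow> E \<in> matrix_class X c0_space) \<and>
         (A \<in> matrix_class X (h_c m) \<longleftrightarrow> E \<in> matrix_class X c_space) \<and>
         (A \<in> matrix_class X (h_inf m) \<longleftrightarrow> E \<in> matrix_class X linf_space)"
  using matrix_class_HDelta_domain_iff[OF assms(3)[folded HDelta_matrix_def]]
  by (simp add: h_0_def h_c_def h_inf_def)

end
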